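(* Let $p>1$ and $b>0$, let $I=(0,1)$, and for $\lambda>0$ consider the problem $$-\left(\int_0^1 |u(x)|^p\,dx+b\right) u''(x) = \lambda u(x)^p \ \ (x\in I),\qquad u(x)>0\ \ (x\in I),\qquad u(0)=u(1)=0. \quad (P)$$ Put $$\lambda_0:=(b(p-1))^{1/p}\,\frac{p}{p-1}\,\|W_p\|_p^{p-1}.$$ (i) If $0<\lambda<\lambda_0$, then $(P)$ has no solution. (ii) If $\lambda=\lambda_0$, then $(P)$ has a unique solution. (iii) If $\lambda>\lambda_0$, then $(P)$ has exactly two solutions $u_{1,\lambda}$ and $u_{2,\lambda}$. Moreover, with a suitable labelling of the two solutions, the following asymptotic formulas hold as $\lambda\to\infty$. For the first solution, with $\alpha=\|u_{1,\lambda}\|_\infty$ (which tends to $0$), $$\lambda=\lambda_1(\alpha)=b\|W_p\|_\infty^{p-1}\alpha^{-(p-1)}\left\{1+b^{-1}\|W_p\|_p^p\|W_p\|_\infty^{-p}\alpha^p(1+o(1))\right\},$$ $$u_{1,\lambda}(x)=b^{1/(p-1)}\lambda^{-1/(p-1)}\left(1+\frac{1}{p-1}b^{1/(p-1)}\|W_p\|_p^p\lambda^{-p/(p-1)}(1+o(1))\right)W_p(x).$$ For the second solution, with $\alpha=\|u_{2,\lambda}\|_\infty$ (which tends to $\infty$), $$\lambda=\lambda_2(\alpha)=\|W_p\|_p^p\|W_p\|_\infty^{-1}\alpha+b\|W_p\|_\infty^{p-1}\alpha^{1-p}+o(\alpha^{1-p}),$$ $$u_{2,\lambda}(x)=\l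eft\{\lambda\|W_p\|_p^{1-p}-b\left(\lambda\|W_p\|_p^{1-p}\right)^{1-p}(1+o(1))\right\}\|W_p\|_p^{-1}W_p(x).$$
   Context: Solutions are classical: $u\in C^2(I)\cap C([0,1])$. For $p>1$, $W_p$ denotes the unique solution (existence and uniqueness are known) of $-W''(x)=W(x)^p$ for $x\in(0,1)$, $W(x)>0$ for $x\in(0,1)$, $W(0)=W(1)=0$. $\|u\|_p=\left(\int_0^1|u(x)|^pdx\right)^{1/p}$ and $\|u\|_\infty=\max_{0\le x\le1}|u(x)|$. The $o(\cdot)$ terms are as $\lambda\to\infty$ and do not depend on $x$ (the solutions are scalar multiples of $W_p$). *)

theory Defs
  imports "HOL-Analysis.Analysis" "HOL-Library.Landau_Symbols"
begin

text \<open>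
  A function on \<open>[0,1]\<close> is an element of \<^term>\<open>extensional {0..1}\<close>, so that equality
  in HOL is equality of functions on \<open>[0,1]\<close> and solutions can be counted.
\<close>

definition classical :: "(real \<Rightarrow> real) \<Rightarrow> bool" where
  "classical u \<longleftrightarrow>
     u \<in> extensional {0..1} \<and>
     continuous_on {0..1} u \<and>
     u differentiable_on {0<..<1} \<and>
     deriv u differentiable_on {0<..<1} \<and>
     continuous_on {0<..<1} (deriv (deriv u))"

definition positive_dirichlet :: "(real \<Rightarrow> real) \<Rightarrow> bool" where
  "positive_dirichlet u \<longleftrightarrow> (\<forall>x\<in>{0<..<1}. u x > 0) \<and> u 0 = 0 \<and> u 1 = 0"

definition W_solution :: "real \<Rightarrow> (real \<Rightarrow> real) \<Rightarrow> bool" where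
  "W_solution p w \<longleftrightarrow>
     classical w \<and> positive_dirichlet w \<and>
     (\<forall>x\<in>{0<..<1}. - deriv (deriv w) x = w x powr p)"

text \<open>Meaningful for \<open>p > 1\<close>, where the solution exists and is unique.\<close>

definition W :: "real \<Rightarrow> real \<Rightarrow> real" where
  "W p = (THE w. W_solution p w)"

definition Lp_norm :: "real \<Rightarrow> (real \<Rightarrow> real) \<Rightarrow> real" where
  "Lp_norm p u = (integral {0..1} (\<lambda>x. \<bar>u x\<bar> powr p)) powr (1 / p)"

text \<open>The supremum is a maximum whenever \<open>u\<close> is continuous on \<open>[0,1]\<close>.\<close>

definition sup_norm :: "(real \<Rightarrow> real) \<Rightarrow> real" where
  "sup_norm u = (SUP x\<in>{0..1}. \<bar>u x\<bar>)"

definition P_solution :: "real \<Rightarrow> real \<Rightarrow> real \<Rightarrow> (real \<Rightarrow> real) \<Rightarrow> bool" where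
  "P_solution p b lam u \<longleftrightarrow>
     classical u \<and> positive_dirichlet u \<and>
     (\<forall>x\<in>{0<..<1}.
        - (integral {0..1} (\<lambda>y. \<bar>u y\<bar> powr p) + b) * deriv (deriv u) x = lam * u x powr p)"

definition lambda0 :: "real \<Rightarrow> real \<Rightarrow> real" where
  "lambda0 p b = (b * (p - 1)) powr (1 / p) * (p / (p - 1)) * Lp_norm p (W p) powr (p - 1)"

end

theory Submission
  imports Defs
begin

text \<open>
  By homogeneity every solution of the nonlocal problem is \<open>t W\<^sub>p\<close> for some \<open>t > 0\<close>, and
  \<open>t W\<^sub>p\<close> is a solution iff \<open>\<lambda> = N t + b t\<^sup>1\<^sup>-\<^sup>p\<close> with \<open>N\<close> the \<open>p\<close>-th power of the
  \<open>L\<^sup>p\<close>-norm of \<open>W\<^sub>p\<close>. The right-hand side decreases to its minimum \<open>\<lambda>\<^sub>0\<close> and then increases,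
  which gives the solution counts. The formulas for \<open>\<lambda>\<close> in terms of the maximum of the solution
  hold with vanishing error; the expansions of \<open>t\<close> in \<open>\<lambda>\<close> follow by rewriting this equation.

  Existence and uniqueness of \<open>W\<^sub>p\<close>: conservation of energy makes \<open>w = m (1 - y\<^sup>2)\<close>, with \<open>y\<close> running
  from \<open>-1\<close> to \<open>1\<close> and changing sign at the maximum of \<open>w\<close>, equivalent to a first-order equation
  \<open>y' = \<kappa> speed(y)\<close> whose right-hand side is continuous and positive on the whole of \<open>[-1,1]\<close>.
  Hence \<open>travel(y(x)) = \<kappa> x\<close> for a primitive \<open>travel\<close> of \<open>1/speed\<close>; the boundary condition
  at \<open>1\<close> determines \<open>\<kappa>\<close>, thus \<open>m\<close>, and then \<open>y\<close>.
\<close>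

subsection \<open>The first-order equation\<close>

text \<open>The value at \<open>0\<close> is the continuous extension.\<close>

definition speed :: "real \<Rightarrow> real \<Rightarrow> real" where
  "speed p y = (if y = 0 then sqrt (p + 1) else sqrt (1 - (1 - y\<^sup>2) powr (p + 1)) / \<bar>y\<bar>)"

lemma powr_lt_one_of_nonzero:
  fixes p y :: real
  assumes "p > 0" "\<bar>y\<bar> \<le> 1" "y \<noteq> 0"
  shows "(1 - y\<^sup>2) powr p < 1"
proof -
  have "y\<^sup>2 > 0" "y\<^sup>2 \<le> 1"
    using assms by (auto simp: abs_square_le_1)
  then show ?thesis
    using powr_less_mono2[of p "1 - y\<^sup>2" 1] assms by simp
qed

lemma speed_pos: "p > 0 \<Longrightarrow> \<bar>y\<bar> \<le> 1 \<Longrightarrow> speed p y > 0"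
  using powr_lt_one_of_nonzero[of "p + 1" y] by (auto simp: speed_def)

lemma mult_speed: "y * speed p y = sgn y * sqrt (1 - (1 - y\<^sup>2) powr (p + 1))"
  by (auto simp: speed_def sgn_if)

lemma isCont_speed:
  assumes "p > 0" "\<bar>y\<bar> < 1"
  shows "isCont (speed p) y"
proof (cases "y = 0")
  case False
  have "y\<^sup>2 < 1" using assms by (simp add: abs_square_less_1)
  then have "isCont (\<lambda>y. sqrt (1 - (1 - y\<^sup>2) powr (p + 1)) / \<bar>y\<bar>) y"
    using False by (intro continuous_intros) auto
  moreover have "eventually (\<lambda>z. speed p z = sqrt (1 - (1 - z\<^sup>2) powr (p + 1)) / \<bar>z\<bar>) (nhds y)"
    using t1_space_nhds[OF False] by eventually_elim (simp add: speed_def)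
  ultimately show ?thesis
    by (simp add: isCont_cong)
next
  case True
  \<comment> \<open>With s = y^2, the square of \<open>speed p y\<close> is minus the difference
    quotient of \<open>(1 - s) powr (p + 1)\<close> at s = 0, so the limit at 0 is read off from
    this derivative.\<close>
  have "((\<lambda>s. (1 - s) powr (p + 1)) has_real_derivative - (p + 1)) (at 0)"
    by (auto intro!: derivative_eq_intros)
  then have "((\<lambda>s. ((1 - s) powr (p + 1) - 1) / s) \<longlongrightarrow> - (p + 1)) (at 0)"
    by (simp add: DERIV_def)
  moreover have "filterlim (\<lambda>y::real. y\<^sup>2) (at 0) (at 0)"
    by (auto simp: filterlim_at eventually_at_filter intro!: tendsto_eq_intros)
  ultimately have "((\<lambda>y. ((1 - y\<^sup>2) powr (p + 1) - 1) / y\<^sup>2) \<longlongrightarrow> - (p + 1)) (at 0)"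
    by (rule filterlim_compose)
  from tendsto_real_sqrt[OF tendsto_minus[OF this]]
  have "((\<lambda>y. sqrt (- (((1 - y\<^sup>2) powr (p + 1) - 1) / y\<^sup>2))) \<longlongrightarrow> sqrt (p + 1)) (at 0)"
    by (simp only: minus_minus)
  moreover have "eventually (\<lambda>y. sqrt (- (((1 - y\<^sup>2) powr (p + 1) - 1) / y\<^sup>2)) = speed p y) (at 0)"
  proof (intro eventually_at_filter[THEN iffD2] always_eventually allI impI)
    fix y :: real assume "y \<noteq> 0"
    have "- (((1 - y\<^sup>2) powr (p + 1) - 1) / y\<^sup>2) = (1 - (1 - y\<^sup>2) powr (p + 1)) / y\<^sup>2"
      by (metis minus_diff_eq minus_divide_left)
    then show "sqrt (- (((1 - y\<^sup>2) powr (p + 1) - 1) / y\<^sup>2)) = speed p y"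
      using \<open>y \<noteq> 0\<close> by (simp only: speed_def real_sqrt_divide real_sqrt_abs if_False)
  qed
  ultimately have "(speed p \<longlongrightarrow> sqrt (p + 1)) (at 0)"
    using Lim_transform_eventually by blast
  then show ?thesis
    by (simp add: True isCont_def speed_def)
qed

lemma continuous_on_speed:
  assumes "p > 0"
  shows "continuous_on {-1..1} (speed p)"
proof -
  have "continuous (at y within {-1..1}) (speed p)" if y: "y \<in> {-1..1}" for y
  proof (cases "y = 0")
    case True
    then show ?thesis
      using isCont_speed[of p 0] assms by (auto intro: continuous_at_imp_continuous_at_within)
  next
    case False
    \<comment> \<open>At y = -1 and y = 1 the base \<open>1 - y\<^sup>2\<close> is 0; continuity of
      the power there rests on the positive exponent and on the base being nonnegative within the
      interval.\<close>
    have "continuous (at y within {-1..1}) (\<lambda>y. sqrt (1 - (1 - y\<^sup>2) powr (p + 1)) / \<bar>y\<bar>)"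
      unfolding continuous_within using False assms y
      by (intro tendsto_intros tendsto_powr2)
         (auto simp: eventually_at_filter abs_square_le_1 intro!: always_eventually)
    then show ?thesis
      by (rule continuous_transform_within[where \<delta> = "\<bar>y\<bar>"])
         (use False y in \<open>auto simp: speed_def dist_real_def\<close>)
  qed
  then show ?thesis
    by (simp add: continuous_on_eq_continuous_within)
qed

text \<open>This carries the second-order equation: if w = a (1 - y^2) and y' = L
  \<open>speed p y\<close>, then w' is -2 a L times this product, and in w'' the chain-rule factor
  y' cancels the \<open>speed\<close> in the denominator, leaving a multiple of (1 - y^2)^p.\<close>

lemma DERIV_mult_speed:
  assumes "p > 0" "\<bar>y\<bar> < 1"
  shows "((\<lambda>y. y * speed p y) has_real_derivative (p + 1) * (1 - y\<^sup>2) powr p / speed p y) (at y)"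
proof (cases "y = 0")
  case True
  have "speed p \<midarrow>0\<rightarrow> sqrt (p + 1)"
    using isCont_speed[of p 0] assms by (simp add: isCont_def speed_def[of p 0])
  \<comment> \<open>At 0 the difference quotient of the product is \<open>speed\<close> itself, so
    continuity of \<open>speed\<close> gives the derivative.\<close>
  then have "(\<lambda>h. (h * speed p h) / h) \<midarrow>0\<rightarrow> sqrt (p + 1)"
    by (rule Lim_transform_eventually) (simp add: eventually_at_filter)
  then show ?thesis
    using assms True by (simp add: DERIV_def speed_def[of p 0] real_div_sqrt)
next
  case False
  have y2: "y\<^sup>2 < 1" using assms by (simp add: abs_square_less_1)
  have pos: "1 - (1 - y\<^sup>2) powr (p + 1) > 0"
    using powr_lt_one_of_nonzero[of "p + 1" y] assms False by auto
  define R where "R = sqrt (1 - (1 - y\<^sup>2) powr (p + 1))"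
  have R: "R > 0" using pos by (simp add: R_def)
  have "((\<lambda>z. (1 - z\<^sup>2) powr (p + 1)) has_real_derivative
      (p + 1) * (1 - y\<^sup>2) powr (p + 1 - 1) * (- (2 * y))) (at y)"
    by (rule DERIV_chain2[OF has_real_derivative_powr]) (use y2 in \<open>auto intro!: derivative_eq_intros\<close>)
  then have "((\<lambda>z. 1 - (1 - z\<^sup>2) powr (p + 1)) has_real_derivative
      0 - (p + 1) * (1 - y\<^sup>2) powr (p + 1 - 1) * (- (2 * y))) (at y)"
    by (intro DERIV_diff DERIV_const)
  then have "((\<lambda>z. sqrt (1 - (1 - z\<^sup>2) powr (p + 1))) has_real_derivative
      inverse R / 2 * (0 - (p + 1) * (1 - y\<^sup>2) powr (p + 1 - 1) * (- (2 * y)))) (at y)"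
    unfolding R_def by (rule DERIV_chain2[where g = "\<lambda>z. 1 - (1 - z\<^sup>2) powr (p + 1)", OF DERIV_real_sqrt[OF pos]])
  then have "((\<lambda>z. sgn y * sqrt (1 - (1 - z\<^sup>2) powr (p + 1))) has_real_derivative
      sgn y * (inverse R / 2 * (0 - (p + 1) * (1 - y\<^sup>2) powr (p + 1 - 1) * (- (2 * y))))) (at y)"
    by (rule DERIV_cmult)
  also have "sgn y * (inverse R / 2 * (0 - (p + 1) * (1 - y\<^sup>2) powr (p + 1 - 1) * (- (2 * y))))
      = (p + 1) * (1 - y\<^sup>2) powr p / speed p y"
  proof -
    have alg: "\<sigma> * (inverse R / 2 * (0 - c * (- (2 * y)))) = c * (\<sigma> * y) / R" for \<sigma> c :: real
      using R by (simp add: field_simps)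
    have "sgn y * y = \<bar>y\<bar>"
      by (simp add: sgn_if)
    moreover have "speed p y = R / \<bar>y\<bar>"
      using False by (simp add: speed_def R_def)
    ultimately show ?thesis
      by (simp only: alg divide_divide_eq_right add_diff_cancel_right')
  qed
  finally have "((\<lambda>z. sgn y * sqrt (1 - (1 - z\<^sup>2) powr (p + 1))) has_real_derivative
      (p + 1) * (1 - y\<^sup>2) powr p / speed p y) (at y)" .
  \<comment> \<open>The sign is constant near a nonzero y, so differentiating with
    \<open>sgn y\<close> held fixed is legitimate.\<close>
  moreover have "eventually (\<lambda>z. sgn y * sqrt (1 - (1 - z\<^sup>2) powr (p + 1)) = z * speed p z) (nhds y)"
  proof -
    have "eventually (\<lambda>z. z \<in> (if y > 0 then {0<..} else {..<0})) (nhds y)"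
      using False by (intro eventually_nhds_in_open) auto
    then show ?thesis
      by eventually_elim (use False in \<open>auto simp: mult_speed sgn_if split: if_splits\<close>)
  qed
  ultimately show ?thesis
    by (rule DERIV_cong_ev[OF refl _ refl, THEN iffD1, rotated])
qed

section \<open>Travel time of y' = \<open>speed p y\<close> from -1 to a given point\<close>

definition travel :: "real \<Rightarrow> real \<Rightarrow> real" where
  "travel p y = integral {-1..y} (\<lambda>z. 1 / speed p z)"

lemma continuous_on_inverse_speed: "p > 0 \<Longrightarrow> continuous_on {-1..1} (\<lambda>z. 1 / speed p z)"
  using speed_pos[of p] by (intro continuous_intros continuous_on_speed) (force simp: abs_le_iff)+

lemma continuous_on_travel: "p > 0 \<Longrightarrow> continuous_on {-1..1} (travel p)"
  unfolding travel_def
  by (intro indefinite_integral_continuous_1 integrable_continuous_interval continuous_on_inverse_speed)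

lemma DERIV_travel:
  assumes "p > 0" "\<bar>y\<bar> < 1"
  shows "(travel p has_real_derivative 1 / speed p y) (at y)"
proof -
  have "(travel p has_real_derivative 1 / speed p y) (at y within {-1..1})"
    unfolding travel_def
    by (rule integral_has_real_derivative) (use assms continuous_on_inverse_speed in auto)
  then show ?thesis
    using assms at_within_interior[of y "{-1..1}"] by (simp add: abs_less_iff)
qed

lemma travel_strict_mono:
  assumes "p > 0" "-1 \<le> y" "y < z" "z \<le> 1"
  shows "travel p y < travel p z"
proof (rule DERIV_pos_imp_increasing_open[OF \<open>y < z\<close>])
  show "\<exists>d. (travel p has_real_derivative d) (at x) \<and> d > 0" if "y < x" "x < z" for x
    using that assms DERIV_travel[of p x] speed_pos[of p x] by (intro exI[of _ "1 / speed p x"]) auto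
  show "continuous_on {y..z} (travel p)"
    using assms by (intro continuous_on_subset[OF continuous_on_travel]) auto
qed

lemma travel_left [simp]: "travel p (-1) = 0"
  by (simp add: travel_def)

lemma travel_pos: "p > 0 \<Longrightarrow> travel p 1 > 0"
  using travel_strict_mono[of p "-1" 1] by simp

section \<open>Classical functions on [0,1] and their derivatives\<close>

lemma classicalD:
  assumes "classical u" "0 < x" "x < 1"
  shows "(u has_real_derivative deriv u x) (at x)"
    and "(deriv u has_real_derivative deriv (deriv u) x) (at x)"
proof -
  have "x \<in> {0<..<1}" using assms by simp
  then show "(u has_real_derivative deriv u x) (at x)"
      and "(deriv u has_real_derivative deriv (deriv u) x) (at x)"
    using assms unfolding classical_def
    by (auto simp: differentiable_on_eq_differentiable_at DERIV_deriv_iff_real_differentiable)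
qed

text \<open>Formulas define functions on the whole line, while solutions are extensional on [0,1].
  Restriction changes nothing near an interior point, so both derivatives survive.\<close>

lemma classical_restrictI:
  fixes u :: "real \<Rightarrow> real"
  assumes "continuous_on {0..1} u"
    and u: "\<And>x. 0 < x \<Longrightarrow> x < 1 \<Longrightarrow> (u has_real_derivative v x) (at x)"
    and v: "\<And>x. 0 < x \<Longrightarrow> x < 1 \<Longrightarrow> (v has_real_derivative a x) (at x)"
    and "continuous_on {0<..<1} a"
  shows "classical (restrict u {0..1})"
    and "\<And>x. 0 < x \<Longrightarrow> x < 1 \<Longrightarrow> deriv (deriv (restrict u {0..1})) x = a x"
proof -
  let ?r = "restrict u {0..1}"
  have ev: "eventually (\<lambda>x. x \<in> {0<..<1}) (nhds x)" if "x \<in> {0<..<1}" for x :: real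
    using that by (intro eventually_nhds_in_open) auto
  have r: "(?r has_real_derivative v x) (at x)" if "x \<in> {0<..<1}" for x
  proof (subst DERIV_cong_ev[OF refl _ refl])
    show "\<forall>\<^sub>F y in nhds x. ?r y = u y"
      using ev[OF that] by eventually_elim simp
  qed (use that u in auto)
  have dr: "(deriv ?r has_real_derivative a x) (at x)" if "x \<in> {0<..<1}" for x
  proof (subst DERIV_cong_ev[OF refl _ refl])
    show "\<forall>\<^sub>F y in nhds x. deriv ?r y = v y"
      using ev[OF that] by eventually_elim (use r DERIV_imp_deriv in blast)
  qed (use that v in auto)
  show ddr: "deriv (deriv ?r) x = a x" if "0 < x" "x < 1" for x
    using dr[of x] that by (intro DERIV_imp_deriv) auto
  have "continuous_on {0..1} ?r"
    using assms(1) by (rule continuous_on_eq) auto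
  moreover have "continuous_on {0<..<1} (deriv (deriv ?r))"
    using assms(4) by (rule continuous_on_eq) (simp add: ddr)
  moreover have "?r differentiable_on {0<..<1}" "deriv ?r differentiable_on {0<..<1}"
    unfolding differentiable_on_eq_differentiable_at[OF open_greaterThanLessThan] real_differentiable_def
    using r dr by blast+
  ultimately show "classical ?r"
    by (auto simp: classical_def)
qed

subsection \<open>Existence and uniqueness of the local problem\<close>

text \<open>The maximum \<open>m\<close> of \<open>W\<^sub>p\<close>, from \<open>\<kappa>\<^sup>2 = m powr (p - 1) / (2 (p + 1))\<close> and \<open>\<kappa> = travel p 1\<close>.\<close>

definition amplitude :: "real \<Rightarrow> real" where
  "amplitude p = (2 * (p + 1) * (travel p 1)\<^sup>2) powr (1 / (p - 1))"

lemma amplitude_pos: "p > 1 \<Longrightarrow> amplitude p > 0"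
  using travel_pos[of p] by (simp add: amplitude_def)

lemma amplitude_powr: "p > 1 \<Longrightarrow> amplitude p powr (p - 1) = 2 * (p + 1) * (travel p 1)\<^sup>2"
  using travel_pos[of p] by (simp add: amplitude_def powr_powr)

text \<open>The reduction is run backwards: \<open>travel p\<close> is inverted, time is rescaled so
  that y goes from -1 to 1 over [0,1], and w is built from y with the prescribed amplitude.\<close>

lemma W_solution_exists:
  assumes p: "p > 1"
  shows "\<exists>w. W_solution p w"
proof -
  define L where "L = travel p 1"
  define g where "g = inv_into {-1..1} (travel p)"
  define a where "a = amplitude p"
  have L: "L > 0" and a: "a > 0"
    using p by (auto simp: L_def a_def travel_pos amplitude_pos)
  have inj: "inj_on (travel p) {-1..1}"
  proof (rule linorder_inj_onI')
    fix y z :: real assume "y \<in> {-1..1}" "z \<in> {-1..1}" "y < z"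
    then show "travel p y \<noteq> travel p z"
      using travel_strict_mono[of p y z] p by simp
  qed
  have img: "travel p ` {-1..1} = {0..L}"
  proof (intro equalityI subsetI)
    fix s assume "s \<in> {0..L}"
    then have "\<exists>y\<ge>-1. y \<le> 1 \<and> travel p y = s"
      using p by (intro IVT') (auto simp: L_def continuous_on_travel)
    then show "s \<in> travel p ` {-1..1}"
      by auto
  next
    fix s assume "s \<in> travel p ` {-1..1}"
    then obtain y where "-1 \<le> y" "y \<le> 1" "s = travel p y" by auto
    then show "s \<in> {0..L}"
      using travel_strict_mono[of p "-1" y] travel_strict_mono[of p y 1] p
      by (cases "y = -1"; cases "y = 1") (auto simp: L_def)
  qed
  have g_travel: "g (travel p y) = y" if "y \<in> {-1..1}" for y
    unfolding g_def using inj that by (rule inv_into_f_f)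
  have travel_g: "travel p (g s) = s" and g_range: "g s \<in> {-1..1}" if "s \<in> {0..L}" for s
    using that f_inv_into_f[of s "travel p" "{-1..1}"] inv_into_into[of s "travel p" "{-1..1}"]
    unfolding g_def img by simp_all
  have g_ends: "g 0 = -1" "g L = 1"
    using g_travel[of "-1"] g_travel[of 1] by (auto simp: L_def)
  have g_cont: "continuous_on {0..L} g"
    unfolding img[symmetric]
    by (rule continuous_on_inv) (use p g_travel in \<open>auto simp: continuous_on_travel\<close>)
  have g_open: "\<bar>g s\<bar> < 1" if "0 < s" "s < L" for s
  proof -
    have "g s \<noteq> -1" "g s \<noteq> 1"
      using travel_g[of s] that by (auto simp: L_def)
    then show ?thesis
      using g_range[of s] that by auto
  qed
  have DERIV_g: "(g has_real_derivative speed p (g s)) (at s)" if s: "0 < s" "s < L" for s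
  proof -
    have "isCont g s"
      by (rule continuous_on_interior[OF g_cont]) (use s in simp)
    then have "(g has_real_derivative inverse (1 / speed p (g s))) (at s)"
      using s DERIV_travel[of p "g s"] g_open[OF s] p speed_pos[of p "g s"] travel_g
      by (intro DERIV_inverse_function[of "travel p" _ g s 0 L]) auto
    then show ?thesis by simp
  qed
  \<comment> \<open>The whole passage takes time \<open>L\<close>, so the factor \<open>L\<close>
    makes it last exactly one unit.\<close>
  define Y where "Y x = g (L * x)" for x
  have Y_open: "\<bar>Y x\<bar> < 1" if "0 < x" "x < 1" for x
    unfolding Y_def by (rule g_open) (use L that in simp_all)
  have DERIV_Y: "(Y has_real_derivative L * speed p (Y x)) (at x)" if "0 < x" "x < 1" for x
  proof -
    have "(g has_real_derivative speed p (g (L * x))) (at (L * x))"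
      by (rule DERIV_g) (use L that in simp_all)
    then have "((\<lambda>x. g (L * x)) has_real_derivative speed p (g (L * x)) * L) (at x)"
      by (rule DERIV_chain2) (auto intro!: derivative_eq_intros)
    then show ?thesis
      by (simp add: Y_def[abs_def] mult.commute)
  qed
  have Y_cont: "continuous_on {0..1} Y"
    unfolding Y_def
    by (rule continuous_on_compose2[OF g_cont]) (use L in \<open>auto intro!: continuous_intros\<close>)
  define w where "w x = a * (1 - (Y x)\<^sup>2)" for x
  have w_pos: "w x > 0" if "0 < x" "x < 1" for x
    using Y_open[OF that] a by (simp add: w_def abs_square_less_1)
  have w_cont: "continuous_on {0..1} w"
    unfolding w_def by (intro continuous_intros Y_cont)
  define v where "v x = - 2 * a * L * (Y x * speed p (Y x))" for x
  have DERIV_w: "(w has_real_derivative v x) (at x)" if "0 < x" "x < 1" for x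
    unfolding w_def v_def
    by (auto intro!: derivative_eq_intros DERIV_Y[OF that])
  have DERIV_v: "(v has_real_derivative - (w x powr p)) (at x)" if x: "0 < x" "x < 1" for x
  proof -
    have Y2: "(Y x)\<^sup>2 < 1"
      using Y_open[OF x] by (simp add: abs_square_less_1)
    have sp: "speed p (Y x) > 0"
      using speed_pos[of p "Y x"] Y_open[OF x] p by simp
    \<comment> \<open>Here the choice of amplitude enters: two differentiations produce the factor 2
      (p + 1) L^2, which has to equal a^(p-1).\<close>
    have ap: "a powr p = a * (2 * (p + 1) * L\<^sup>2)"
      using a amplitude_powr[OF p] by (simp add: a_def L_def powr_diff field_simps)
    have "((\<lambda>x. Y x * speed p (Y x)) has_real_derivative
        (p + 1) * (1 - (Y x)\<^sup>2) powr p / speed p (Y x) * (L * speed p (Y x))) (at x)"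
      by (rule DERIV_chain2[OF DERIV_mult_speed DERIV_Y]) (use x p Y_open in auto)
    then have "(v has_real_derivative - 2 * a * L * 
        ((p + 1) * (1 - (Y x)\<^sup>2) powr p / speed p (Y x) * (L * speed p (Y x)))) (at x)"
      unfolding v_def by (rule DERIV_cmult)
    also have "- 2 * a * L * ((p + 1) * (1 - (Y x)\<^sup>2) powr p / speed p (Y x) * (L * speed p (Y x)))
        = - (w x powr p)"
      using sp a Y2 by (simp add: w_def powr_mult ap power2_eq_square)
    finally show ?thesis .
  qed
  have "continuous_on {0<..<1} w"
    using w_cont by (rule continuous_on_subset) auto
  then have rhs_cont: "continuous_on {0<..<1} (\<lambda>x. - (w x powr p))"
    using w_pos by (auto intro!: continuous_intros simp: less_imp_neq[symmetric])
  note W = classical_restrictI[OF w_cont DERIV_w DERIV_v rhs_cont]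
  have "w 0 = 0" "w 1 = 0"
    by (simp_all add: w_def Y_def g_ends)
  then have "W_solution p (restrict w {0..1})"
    unfolding W_solution_def positive_dirichlet_def
    by (intro conjI ballI W(1)) (simp_all add: W(2) w_pos)
  then show ?thesis by blast
qed

text \<open>The conclusion is shaped for uniqueness: \<open>travel p\<close> is injective on [-1,1],
  so \<open>y x\<close> and with it \<open>w x\<close> depend on p and x alone. Concavity gives a
  single maximum, and energy conservation gives the size of w' in terms of w.\<close>

lemma W_solution_shape:
  assumes p: "p > 1" and w: "W_solution p w"
  shows "\<exists>y. \<forall>x\<in>{0..1}. y x \<in> {-1..1} \<and> travel p (y x) = travel p 1 * x \<and>
    w x = amplitude p * (1 - (y x)\<^sup>2)"
proof -
  have cl: "classical w" and w01: "w 0 = 0" "w 1 = 0" and wpos: "\<And>x. 0 < x \<Longrightarrow> x < 1 \<Longrightarrow> w x > 0"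
    and ode: "\<And>x. 0 < x \<Longrightarrow> x < 1 \<Longrightarrow> deriv (deriv w) x = - (w x powr p)"
    using w by (force simp: W_solution_def positive_dirichlet_def)+
  have cont: "continuous_on {0..1} w"
    using cl by (simp add: classical_def)
  define v where "v = deriv w"
  have Dw: "(w has_real_derivative v x) (at x)" if "0 < x" "x < 1" for x
    using classicalD(1)[OF cl that] by (simp add: v_def)
  have Dv: "(v has_real_derivative - (w x powr p)) (at x)" if "0 < x" "x < 1" for x
    using classicalD(2)[OF cl that] ode[OF that] by (simp add: v_def)
  obtain c where c: "c \<in> {0..1}" and max: "\<And>x. x \<in> {0..1} \<Longrightarrow> w x \<le> w c"
    using continuous_attains_sup[OF _ _ cont] by auto
  define m where "m = w c"
  have m: "m > 0"
    using wpos[of "1/2"] max[of "1/2"] by (auto simp: m_def)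
  have c01: "0 < c" "c < 1"
    using m w01 c by (auto simp: m_def less_le)
  have vc: "v c = 0"
    by (rule DERIV_local_max[OF Dw[OF c01], of "min c (1 - c)"])
       (use c01 in \<open>auto intro!: max simp: abs_less_iff\<close>)
  \<comment> \<open>Since w'' < 0 inside, w' vanishes only at \<open>c\<close>; this is where y has
    to change sign.\<close>
  have v_anti: "v y < v x" if "0 < x" "x < y" "y < 1" for x y
  proof (rule DERIV_neg_imp_decreasing[OF \<open>x < y\<close>])
    show "\<exists>d. (v has_real_derivative d) (at z) \<and> d < 0" if "x \<le> z" "z \<le> y" for z
      using that \<open>0 < x\<close> \<open>y < 1\<close> Dv[of z] wpos[of z] by (intro exI[of _ "- (w z powr p)"]) auto
  qed
  have v_pos: "v x > 0" if "0 < x" "x < c" for x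
    using v_anti[of x c] that c01 vc by simp
  have v_neg: "v x < 0" if "c < x" "x < 1" for x
    using v_anti[of c x] that c01 vc by simp
  have w_lt: "w x < m" if "x \<in> {0..1}" "x \<noteq> c" for x
  proof (cases "x < c")
    case True
    show ?thesis unfolding m_def
    proof (rule DERIV_pos_imp_increasing_open[OF True])
      show "\<exists>d. (w has_real_derivative d) (at z) \<and> d > 0" if "x < z" "z < c" for z
        using that Dw[of z] v_pos[of z] \<open>x \<in> {0..1}\<close> c01 by (intro exI[of _ "v z"]) auto
      show "continuous_on {x..c} w"
        using that c by (intro continuous_on_subset[OF cont]) auto
    qed
  next
    case False
    then have "c < x" using that by simp
    then show ?thesis unfolding m_def
    proof (rule DERIV_neg_imp_decreasing_open)
      show "\<exists>d. (w has_real_derivative d) (at z) \<and> d < 0" if "c < z" "z < x" for z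
        using that Dw[of z] v_neg[of z] \<open>x \<in> {0..1}\<close> c01 by (intro exI[of _ "v z"]) auto
      show "continuous_on {c..x} w"
        using that c by (intro continuous_on_subset[OF cont]) auto
    qed
  qed
  \<comment> \<open>The sum of v^2 / 2 and w^(p+1) / (p+1) is conserved; its value is read off at
    \<open>c\<close>, where v = 0.\<close>
  have energy: "(v x)\<^sup>2 = 2 / (p + 1) * (m powr (p + 1) - w x powr (p + 1))" if x: "0 < x" "x < 1" for x
  proof -
    let ?E = "\<lambda>x. (v x)\<^sup>2 / 2 + w x powr (p + 1) / (p + 1)"
    have "(?E has_real_derivative 0) (at z)" if "0 < z" "z < 1" for z
      using wpos[OF that] p
      by (auto intro!: derivative_eq_intros Dv[OF that] Dw[OF that] simp: powr_diff)
    then have "(?E has_real_derivative 0) (at z within {0<..<1})" if "z \<in> {0<..<1}" for z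
      using that DERIV_subset by force
    then have "\<exists>K. \<forall>z\<in>{0<..<1}. ?E z = K"
      by (intro has_field_derivative_zero_constant) auto
    then have "?E x = ?E c"
      using x c01 by (metis greaterThanLessThan_iff)
    then have "(v x)\<^sup>2 = 2 * (m powr (p + 1) / (p + 1)) - 2 * (w x powr (p + 1) / (p + 1))"
      using vc by (simp add: m_def)
    then show ?thesis
      by (simp add: right_diff_distrib diff_divide_distrib)
  qed
  \<comment> \<open>The branch of the square root: negative before the maximum and positive after
    it, so that y increases through 0.\<close>
  define s where "s x = (if x < c then -1 else 1 :: real)" for x
  define y where "y x = s x * sqrt (1 - w x / m)" for x
  have y2: "(y x)\<^sup>2 = 1 - w x / m" if "x \<in> {0..1}" for x
    using max[OF that] m by (simp add: y_def s_def power_mult_distrib m_def)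
  have w_y: "w x = m * (1 - (y x)\<^sup>2)" if "x \<in> {0..1}" for x
    using y2[OF that] m by (simp add: field_simps)
  have w_nonneg: "w x \<ge> 0" if "x \<in> {0..1}" for x
    using wpos[of x] w01 that by (cases "x = 0 \<or> x = 1") auto
  have y_range: "y x \<in> {-1..1}" if "x \<in> {0..1}" for x
  proof -
    have "(y x)\<^sup>2 \<le> 1" using y2[OF that] w_nonneg[OF that] m by simp
    then show ?thesis by (auto simp: abs_square_le_1 abs_le_iff)
  qed
  have y_cont: "continuous_on {0..1} y"
  proof -
    \<comment> \<open>Both branches vanish at \<open>c\<close>, so they glue continuously and the
      sign assigned at \<open>c\<close> itself does not affect y.\<close>
    have "continuous_on ({0..c} \<union> {c..1}) (\<lambda>x. if x \<le> c then - sqrt (1 - w x / m) else sqrt (1 - w x / m))"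
      by (rule continuous_on_If)
         (use m c01 in \<open>auto intro!: continuous_intros continuous_on_subset[OF cont] simp: m_def\<close>)
    moreover have "{0..c} \<union> {c..1} = {0..1}" using c01 by auto
    ultimately have "continuous_on {0..1} (\<lambda>x. if x \<le> c then - sqrt (1 - w x / m) else sqrt (1 - w x / m))"
      by simp
    then show ?thesis
      by (rule continuous_on_eq) (use m in \<open>auto simp: y_def s_def m_def\<close>)
  qed
  \<comment> \<open>The constant for which (2 / (p + 1)) m^(p+1) = (2 m k)^2, so that the energy
    identity becomes y' = k \<open>speed p (y x)\<close>.\<close>
  define k where "k = sqrt (m powr (p - 1) / (2 * (p + 1)))"
  \<comment> \<open>The point \<open>c\<close> is left out because the square root is not
    differentiable at 0.\<close>
  have Dy: "(y has_real_derivative k * speed p (y x)) (at x)" if x: "0 < x" "x < 1" "x \<noteq> c" for x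
  proof -
    have wm: "w x < m" and w0: "w x > 0" using w_lt[of x] wpos[of x] x by auto
    have q: "1 - w x / m > 0" using wm m by simp
    define r where "r = 1 - w x / m"
    have wr: "w x = m * (1 - r)" using m by (simp add: r_def field_simps)
    have r: "0 < r" "r < 1" using q w0 m by (auto simp: r_def)
    have sg: "v x = - s x * \<bar>v x\<bar>"
      using v_pos[of x] v_neg[of x] x by (cases "x < c") (auto simp: s_def)
    have "\<bar>v x\<bar> = sqrt (2 / (p + 1) * (m powr (p + 1) - w x powr (p + 1)))"
      using energy[of x] x by (metis real_sqrt_abs)
    also have "\<dots> = sqrt (2 / (p + 1) * m powr (p + 1) * (1 - (1 - r) powr (p + 1)))"
    proof -
      have "w x powr (p + 1) = m powr (p + 1) * (1 - r) powr (p + 1)"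
        unfolding wr by (rule powr_mult)
      then show ?thesis by (simp add: right_diff_distrib)
    qed
    also have "\<dots> = 2 * m * k * sqrt (1 - (1 - r) powr (p + 1))"
    proof -
      have "2 / (p + 1) * m powr (p + 1) = (2 * m)\<^sup>2 * (m powr (p - 1) / (2 * (p + 1)))"
      proof -
        have "m powr (p + 1) = m powr (p - 1) * m powr 2"
          by (simp add: add.commute flip: powr_add)
        then have "m powr (p + 1) = m powr (p - 1) * m\<^sup>2"
          using m by simp
        then show ?thesis
          using p by (simp add: power_mult_distrib divide_simps)
      qed
      then show ?thesis using m p
        by (simp only: k_def real_sqrt_mult real_sqrt_abs)
    qed
    finally have av: "\<bar>v x\<bar> = 2 * m * k * sqrt (1 - (1 - r) powr (p + 1))" .
    have ay: "\<bar>y x\<bar> = sqrt r" and yx: "(y x)\<^sup>2 = r" "y x \<noteq> 0"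
      using r by (auto simp: y_def s_def r_def)
    have sp: "speed p (y x) = sqrt (1 - (1 - r) powr (p + 1)) / sqrt r"
      using yx ay by (simp add: speed_def)
    have "((\<lambda>z. s x * sqrt (1 - w z / m)) has_real_derivative
        s x * (- (v x / m) / (2 * sqrt r))) (at x)"
      using q m
      by (auto intro!: derivative_eq_intros Dw x simp: r_def field_simps)
    also have "s x * (- (v x / m) / (2 * sqrt r)) = k * speed p (y x)"
      using m r by (subst sg) (simp add: av sp s_def field_simps)
    finally have "((\<lambda>z. s x * sqrt (1 - w z / m)) has_real_derivative k * speed p (y x)) (at x)" .
    moreover have "eventually (\<lambda>z. s x * sqrt (1 - w z / m) = y z) (nhds x)"
    proof -
      have "eventually (\<lambda>z. z \<in> (if x < c then {..<c} else {c<..})) (nhds x)"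
        using x by (intro eventually_nhds_in_open) auto
      then show ?thesis
        by eventually_elim (use x in \<open>auto simp: y_def s_def split: if_splits\<close>)
    qed
    ultimately show ?thesis
      by (rule DERIV_cong_ev[OF refl _ refl, THEN iffD1, rotated])
  qed
  have y_ends: "y 0 = -1" "y 1 = 1"
    using c01 w01 by (auto simp: y_def s_def)
  have travel_y: "travel p (y x) = k * x" if "x \<in> {0..1}" for x
  proof -
    have "travel p (y x) - k * x = 0"
    \<comment> \<open>No derivative of y at \<open>c\<close> is required: a continuous function
      whose derivative vanishes off a finite set is constant, and this one starts at 0.\<close>
    proof (rule has_derivative_zero_unique_strong_interval[where k = "{0, c, 1}" and a = 0 and b = 1
          and f = "\<lambda>x. travel p (y x) - k * x"])
      show "continuous_on {0..1} (\<lambda>x. travel p (y x) - k * x)"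
        using p y_range
        by (intro continuous_intros continuous_on_compose2[OF continuous_on_travel y_cont]) auto
      fix x assume "x \<in> {0..1} - {0, c, 1}"
      then have x: "0 < x" "x < 1" "x \<noteq> c" by auto
      have "(y x)\<^sup>2 < 1" using y2[of x] wpos[of x] x m by simp
      then have yx: "\<bar>y x\<bar> < 1" by (simp add: abs_square_less_1)
      have "speed p (y x) > 0" using speed_pos[of p "y x"] p yx by simp
      then have "((\<lambda>x. travel p (y x) - k * x) has_real_derivative 0) (at x)"
        using DERIV_chain2[OF DERIV_travel[of p] Dy[OF x]] p yx
        by (auto intro!: derivative_eq_intros)
      then show "((\<lambda>x. travel p (y x) - k * x) has_derivative (\<lambda>h. 0)) (at x within {0..1})"
        by (auto simp: has_field_derivative_def lambda_zero intro: has_derivative_at_withinI)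
    qed (use that y_ends in auto)
    then show ?thesis by simp
  qed
  \<comment> \<open>The boundary condition y = 1 at x = 1 fixes \<open>k\<close>; inverting the
    definition of \<open>k\<close> then fixes the maximum \<open>m\<close>.\<close>
  have k: "k = travel p 1"
    using travel_y[of 1] y_ends by simp
  have "m = amplitude p"
  proof -
    have "m = (m powr (p - 1)) powr (1 / (p - 1))"
      using m p by (simp add: powr_powr)
    also have "m powr (p - 1) = 2 * (p + 1) * k\<^sup>2"
      using p by (simp add: k_def)
    finally show ?thesis
      by (simp add: amplitude_def k)
  qed
  then show ?thesis
    using y_range travel_y w_y k by blast
qed

lemma W_solution_unique:
  assumes p: "p > 1" and w: "W_solution p w" and w': "W_solution p w'"
  shows "w = w'"
proof
  fix x
  obtain y where y: "\<forall>x\<in>{0..1}. y x \<in> {-1..1} \<and> travel p (y x) = travel p 1 * x \<and>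
      w x = amplitude p * (1 - (y x)\<^sup>2)"
    using W_solution_shape[OF p w] by blast
  obtain y' where y': "\<forall>x\<in>{0..1}. y' x \<in> {-1..1} \<and> travel p (y' x) = travel p 1 * x \<and>
      w' x = amplitude p * (1 - (y' x)\<^sup>2)"
    using W_solution_shape[OF p w'] by blast
  show "w x = w' x"
  proof (cases "x \<in> {0..1}")
    case True
    have "y x = y' x"
      using travel_strict_mono[of p "y x" "y' x"] travel_strict_mono[of p "y' x" "y x"] y y' True p
      by (cases "y x" "y' x" rule: linorder_cases) auto
    then show ?thesis using y y' True by simp
  next
    case False
    have "w \<in> extensional {0..1}" "w' \<in> extensional {0..1}"
      using w w' by (auto simp: W_solution_def classical_def)
    then show ?thesis using False by (simp add: extensional_def)
  qed
qed

lemma W_solution_W: "p > 1 \<Longrightarrow> W_solution p (W p)"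
  unfolding W_def
  by (rule theI'[of "W_solution p"]) (blast intro: W_solution_exists W_solution_unique)

subsection \<open>Reduction of the nonlocal problem to a scalar equation\<close>

lemma classical_scale:
  assumes "classical w"
  shows "classical (restrict (\<lambda>x. t * w x) {0..1})"
    and "0 < x \<Longrightarrow> x < 1 \<Longrightarrow>
      deriv (deriv (restrict (\<lambda>x. t * w x) {0..1})) x = t * deriv (deriv w) x"
proof -
  have "continuous_on {0..1} w" "continuous_on {0<..<1} (deriv (deriv w))"
    using assms by (simp_all add: classical_def)
  then have "continuous_on {0..1} (\<lambda>x. t * w x)" "continuous_on {0<..<1} (\<lambda>x. t * deriv (deriv w) x)"
    by (auto intro: continuous_intros)
  note * = classical_restrictI[OF this(1) DERIV_cmult[OF classicalD(1)[OF assms]]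
      DERIV_cmult[OF classicalD(2)[OF assms]] this(2)]
  show "classical (restrict (\<lambda>x. t * w x) {0..1})"
    using *(1) by simp
  show "deriv (deriv (restrict (\<lambda>x. t * w x) {0..1})) x = t * deriv (deriv w) x" if "0 < x" "x < 1"
    using *(2)[of x] that by simp
qed

lemma positive_dirichlet_scale:
  "positive_dirichlet w \<Longrightarrow> t > 0 \<Longrightarrow> positive_dirichlet (restrict (\<lambda>x. t * w x) {0..1})"
  by (simp add: positive_dirichlet_def)

lemma integral_powr_scale:
  fixes w :: "real \<Rightarrow> real"
  assumes "t > 0"
  shows "integral {0..1} (\<lambda>x. \<bar>restrict (\<lambda>x. t * w x) {0..1} x\<bar> powr p) =
    t powr p * integral {0..1} (\<lambda>x. \<bar>w x\<bar> powr p)"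
proof -
  have "integral {0..1} (\<lambda>x. \<bar>restrict (\<lambda>x. t * w x) {0..1} x\<bar> powr p) =
      integral {0..1} (\<lambda>x. t powr p * \<bar>w x\<bar> powr p)"
    using assms by (intro integral_cong) (simp add: abs_mult powr_mult)
  then show ?thesis by simp
qed

lemma sup_norm_eq_max:
  assumes "c \<in> {0..1}" "\<And>x. x \<in> {0..1} \<Longrightarrow> \<bar>u x\<bar> \<le> \<bar>u c\<bar>"
  shows "sup_norm u = \<bar>u c\<bar>"
  unfolding sup_norm_def by (rule cSup_eq_maximum) (use assms in auto)

lemma sup_norm_scale:
  assumes "continuous_on {0..1} w" "t > 0"
  shows "sup_norm (restrict (\<lambda>x. t * w x) {0..1}) = t * sup_norm w"
proof -
  have "continuous_on {0..1} (\<lambda>x. \<bar>w x\<bar>)"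
    using assms(1) by (intro continuous_intros)
  then obtain c where c: "c \<in> {0..1}" "\<And>x. x \<in> {0..1} \<Longrightarrow> \<bar>w x\<bar> \<le> \<bar>w c\<bar>"
    using continuous_attains_sup[of "{0..1}" "\<lambda>x. \<bar>w x\<bar>"] by auto
  then show ?thesis
    using assms(2) sup_norm_eq_max[of c w] sup_norm_eq_max[of c "restrict (\<lambda>x. t * w x) {0..1}"]
    by (simp add: abs_mult)
qed

section \<open>Positive multiples of \<open>W p\<close> as solutions of (P)\<close>

definition scaled_W :: "real \<Rightarrow> real \<Rightarrow> real \<Rightarrow> real" where
  "scaled_W p t = restrict (\<lambda>x. t * W p x) {0..1}"

context
  fixes p :: real
  assumes p: "p > 1"
begin

lemma W_classical: "classical (W p)"
  and W_positive_dirichlet: "positive_dirichlet (W p)"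
  and W_ode: "0 < x \<Longrightarrow> x < 1 \<Longrightarrow> deriv (deriv (W p)) x = - (W p x powr p)"
  using W_solution_W[OF p] by (force simp: W_solution_def)+

lemma W_pos: "0 < x \<Longrightarrow> x < 1 \<Longrightarrow> W p x > 0"
  using W_positive_dirichlet by (simp add: positive_dirichlet_def)

lemma continuous_on_W: "continuous_on {0..1} (W p)"
  using W_classical by (simp add: classical_def)

lemma sup_norm_W_pos: "sup_norm (W p) > 0"
proof -
  have "continuous_on {0..1} (\<lambda>x. \<bar>W p x\<bar>)"
    using continuous_on_W by (intro continuous_intros)
  then obtain c where c: "c \<in> {0..1}" "\<And>x. x \<in> {0..1} \<Longrightarrow> \<bar>W p x\<bar> \<le> \<bar>W p c\<bar>"
    using continuous_attains_sup[of "{0..1}" "\<lambda>x. \<bar>W p x\<bar>"] by auto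
  then show ?thesis
    using W_pos[of "1/2"] c(2)[of "1/2"] sup_norm_eq_max[of c "W p"] c by simp
qed

lemma integral_W_powr_pos: "integral {0..1} (\<lambda>x. \<bar>W p x\<bar> powr p) > 0"
proof -
  have "continuous_on {0..1} (\<lambda>x. \<bar>W p x\<bar> powr p)"
    using p by (intro continuous_on_powr' continuous_intros continuous_on_W) auto
  moreover have "integral {0..1} (\<lambda>x. \<bar>W p x\<bar> powr p) \<noteq> 0"
  proof
    assume "integral {0..1} (\<lambda>x. \<bar>W p x\<bar> powr p) = 0"
    then have "\<forall>x\<in>{0..1}. \<bar>W p x\<bar> powr p = 0"
      using integral_eq_0_iff[OF calculation] by simp
    then show False
      using W_pos[of "1/2"] by (auto dest: bspec[of _ _ "1/2"])
  qed
  ultimately show ?thesis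
    by (simp add: less_le integral_nonneg integrable_continuous_interval)
qed

lemma Lp_norm_W_pos: "Lp_norm p (W p) > 0"
  using integral_W_powr_pos by (simp add: Lp_norm_def)

lemma Lp_norm_W_powr: "integral {0..1} (\<lambda>x. \<bar>W p x\<bar> powr p) = Lp_norm p (W p) powr p"
  using integral_W_powr_pos p by (simp add: Lp_norm_def powr_powr)

lemma scaled_W_inject: "scaled_W p s = scaled_W p t \<longleftrightarrow> s = t"
  using W_pos[of "1/2"] by (auto simp: scaled_W_def dest!: fun_cong[of _ _ "1/2"])

text \<open>For t W the nonlocal coefficient is t^p N + b, with N the integral of W^p, and the
  second derivative is -t W^p. Both sides are therefore multiples of W^p, and only their
  coefficients have to agree.\<close>

lemma P_solution_scaled_W:
  assumes t: "t > 0" and lam: "lam = Lp_norm p (W p) powr p * t + b * t powr (1 - p)"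
  shows "P_solution p b lam (scaled_W p t)"
proof -
  have eq: "(t powr p * Lp_norm p (W p) powr p + b) * t = lam * t powr p"
  proof -
    have "t powr (1 - p) * t powr p = t" using t by (simp flip: powr_add)
    then show ?thesis by (simp add: lam algebra_simps)
  qed
  show ?thesis
    unfolding P_solution_def scaled_W_def
  proof (intro conjI ballI)
    fix x :: real assume "x \<in> {0<..<1}"
    then have x: "0 < x" "x < 1" by auto
    have "- (t powr p * Lp_norm p (W p) powr p + b) * (t * - (W p x powr p)) =
        ((t powr p * Lp_norm p (W p) powr p + b) * t) * W p x powr p"
      by (simp add: algebra_simps)
    also have "\<dots> = lam * (t * W p x) powr p"
      unfolding eq by (simp add: powr_mult)
    finally show "- (integral {0..1} (\<lambda>y. \<bar>restrict (\<lambda>x. t * W p x) {0..1} y\<bar> powr p) + b) *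
        deriv (deriv (restrict (\<lambda>x. t * W p x) {0..1})) x =
        lam * restrict (\<lambda>x. t * W p x) {0..1} x powr p"
      using x by (simp only: classical_scale(2)[OF W_classical x] integral_powr_scale[OF t]
          Lp_norm_W_powr W_ode[OF x]) simp
  qed (use t in \<open>simp_all add: classical_scale W_classical positive_dirichlet_scale W_positive_dirichlet\<close>)
qed

text \<open>For a fixed u the nonlocal coefficient \<mu> is just a positive number, so u solves a
  local equation with factor lam / \<mu>. Scaling by \<open>c\<close> with c^(p-1) = lam / \<mu>
  absorbs this factor, and uniqueness identifies the result with \<open>W p\<close>.\<close>

lemma P_solutionE:
  assumes b: "b > 0" and lam: "lam > 0" and u: "P_solution p b lam u"
  obtains t where "t > 0" "lam = Lp_norm p (W p) powr p * t + b * t powr (1 - p)" "u = scaled_W p t"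
proof -
  define \<mu> where "\<mu> = integral {0..1} (\<lambda>y. \<bar>u y\<bar> powr p) + b"
  define c where "c = (lam / \<mu>) powr (1 / (p - 1))"
  have cl: "classical u" and dir: "positive_dirichlet u"
    and ode: "\<And>x. 0 < x \<Longrightarrow> x < 1 \<Longrightarrow> - \<mu> * deriv (deriv u) x = lam * u x powr p"
    using u by (auto simp: P_solution_def \<mu>_def)
  have "integral {0..1} (\<lambda>y. \<bar>u y\<bar> powr p) \<ge> 0"
    using cl p unfolding classical_def
    by (intro integral_nonneg integrable_continuous_interval continuous_on_powr' continuous_intros) auto
  then have \<mu>: "\<mu> > 0" using b by (simp add: \<mu>_def)
  have c: "c > 0" and c_powr: "c powr (p - 1) = lam / \<mu>"
    using lam \<mu> p by (simp_all add: c_def powr_powr)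
  have cp: "c powr p = c * (lam / \<mu>)"
    using c c_powr by (metis powr_mult_base less_imp_le add.commute diff_add_cancel)
  have "W_solution p (restrict (\<lambda>x. c * u x) {0..1})"
    unfolding W_solution_def
  proof (intro conjI ballI classical_scale(1) positive_dirichlet_scale cl dir c)
    fix x :: real assume "x \<in> {0<..<1}"
    then have x: "0 < x" "x < 1" by auto
    have "u x > 0" using dir x by (simp add: positive_dirichlet_def)
    moreover have "deriv (deriv u) x = - (lam / \<mu> * u x powr p)"
      using ode[OF x] \<mu> by (simp add: field_simps)
    ultimately show "- deriv (deriv (restrict (\<lambda>x. c * u x) {0..1})) x =
        restrict (\<lambda>x. c * u x) {0..1} x powr p"
      using x c by (simp add: classical_scale(2)[OF cl x] powr_mult cp)
  qed
  then have W: "restrict (\<lambda>x. c * u x) {0..1} = W p"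
    using W_solution_W W_solution_unique p by blast
  define t where "t = 1 / c"
  have t: "t > 0" using c by (simp add: t_def)
  have u_eq: "u = scaled_W p t"
  proof
    fix x
    show "u x = scaled_W p t x"
    proof (cases "x \<in> {0..1}")
      case True
      then show ?thesis
        using c by (simp add: scaled_W_def t_def flip: W)
    next
      case False
      then show ?thesis
        using cl by (auto simp: scaled_W_def classical_def extensional_def)
    qed
  qed
  \<comment> \<open>Self-consistency: \<mu> recomputed from u = t W must be the number used in the
    scaling. Together with t^(1-p) = lam / \<mu> this is the scalar equation.\<close>
  have "\<mu> = t powr p * Lp_norm p (W p) powr p + b"
    unfolding \<mu>_def u_eq scaled_W_def by (simp only: integral_powr_scale[OF t] Lp_norm_W_powr)
  moreover have "lam = t powr (1 - p) * \<mu>"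
  proof -
    have "t powr (1 - p) = c powr (p - 1)"
      using c by (simp add: t_def powr_divide flip: powr_minus_divide)
    then show ?thesis using c_powr \<mu> by simp
  qed
  moreover have "t powr (1 - p) * t powr p = t"
    using t by (simp flip: powr_add)
  ultimately have "lam = Lp_norm p (W p) powr p * t + b * t powr (1 - p)"
    by (simp add: algebra_simps)
  with t u_eq show thesis using that by blast
qed

end

subsection \<open>The scalar equation\<close>

text \<open>The value of \<lambda> for which t W solves (P), with \<open>N\<close> standing for the
  p-th power of the Lp norm of W.\<close>

definition load :: "real \<Rightarrow> real \<Rightarrow> real \<Rightarrow> real \<Rightarrow> real" where
  "load N b p t = N * t + b * t powr (1 - p)"

text \<open>The positive zero of the derivative N - b (p - 1) t^(-p) of \<open>load\<close>.\<close>

definition crit :: "real \<Rightarrow> real \<Rightarrow> real \<Rightarrow> real" where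
  "crit N b p = (b * (p - 1) / N) powr (1 / p)"

context
  fixes N b p :: real
  assumes N: "N > 0" and b: "b > 0" and p: "p > 1"
begin

lemma crit_pos: "crit N b p > 0"
  using N b p by (simp add: crit_def)

lemma crit_powr: "crit N b p powr p = b * (p - 1) / N"
  using N b p by (simp add: crit_def powr_powr)

lemma DERIV_load:
  assumes "t > 0"
  shows "(load N b p has_real_derivative N - b * (p - 1) / t powr p) (at t)"
proof -
  have "(load N b p has_real_derivative N * 1 + b * ((1 - p) * t powr (1 - p - 1))) (at t)"
    unfolding load_def
    by (intro DERIV_add DERIV_cmult DERIV_ident has_real_derivative_powr assms)
  also have "N * 1 + b * ((1 - p) * t powr (1 - p - 1)) = N - b * (p - 1) / t powr p"
    by (simp add: powr_minus_divide algebra_simps diff_divide_distrib)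
  finally show ?thesis .
qed

lemma isCont_load: "t > 0 \<Longrightarrow> isCont (load N b p) t"
  using DERIV_load DERIV_isCont by blast

lemma load_decreasing:
  assumes "0 < s" "s < t" "t \<le> crit N b p"
  shows "load N b p t < load N b p s"
proof (rule DERIV_neg_imp_decreasing_open[OF \<open>s < t\<close>])
  fix x assume x: "s < x" "x < t"
  have "x powr p < b * (p - 1) / N"
    using powr_less_mono2[of p x "crit N b p"] x assms p by (simp add: crit_powr)
  then have "N - b * (p - 1) / x powr p < 0"
    using N x assms by (simp add: field_simps)
  then show "\<exists>d. (load N b p has_real_derivative d) (at x) \<and> d < 0"
    using DERIV_load x assms by (meson less_trans)
next
  show "continuous_on {s..t} (load N b p)"
    using assms by (intro continuous_at_imp_continuous_on ballI isCont_load) auto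
qed

lemma load_increasing:
  assumes "crit N b p \<le> s" "s < t"
  shows "load N b p s < load N b p t"
proof (rule DERIV_pos_imp_increasing_open[OF \<open>s < t\<close>])
  fix x assume x: "s < x" "x < t"
  have "x powr p > b * (p - 1) / N"
    using powr_less_mono2[of p "crit N b p" x] x assms p crit_pos by (simp add: crit_powr)
  moreover have "x > 0" using x assms crit_pos by simp
  ultimately have "N - b * (p - 1) / x powr p > 0"
    using N by (simp add: field_simps)
  then show "\<exists>d. (load N b p has_real_derivative d) (at x) \<and> d > 0"
    using DERIV_load \<open>x > 0\<close> by blast
next
  show "continuous_on {s..t} (load N b p)"
    using assms crit_pos by (intro continuous_at_imp_continuous_on ballI isCont_load) auto
qed

text \<open>At the critical point t^p = b (p - 1) / N, so the second summand of \<open>load\<close>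
  is N t / (p - 1).\<close>

lemma load_crit: "load N b p (crit N b p) = N * crit N b p * p / (p - 1)"
proof -
  have "crit N b p powr (1 - p) = crit N b p * (N / (b * (p - 1)))"
    using crit_pos by (simp add: powr_diff crit_powr)
  then show ?thesis
    using N b p by (simp add: load_def field_simps)
qed

lemma load_crit_le: "t > 0 \<Longrightarrow> load N b p (crit N b p) \<le> load N b p t"
  using load_decreasing[of t "crit N b p"] load_increasing[of "crit N b p" t]
  by (cases t "crit N b p" rule: linorder_cases) auto

text \<open>Each summand alone bounds \<open>load\<close> from below. This shows where
  \<open>load\<close> exceeds a given level, far out by the first and near 0 by the second.\<close>

lemma load_ge_branches:
  assumes "t > 0"
  shows "load N b p t > N * t" "load N b p t > b * t powr (1 - p)"
  using assms N b by (simp_all add: load_def)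

section \<open>Existence and number of the roots\<close>

lemma ex_small_root:
  assumes lam: "lam > load N b p (crit N b p)"
  shows "\<exists>t. 0 < t \<and> t < crit N b p \<and> load N b p t = lam"
proof -
  have lam0: "lam > 0"
    using lam load_crit N p crit_pos by (smt (verit) divide_pos_pos mult_pos_pos)
  \<comment> \<open>The point where b t^(1-p) alone reaches \<open>lam\<close>, capped at the
    critical point; \<open>load\<close> lies above \<open>lam\<close> there, so a root lies between
    it and the critical point.\<close>
  define t0 where "t0 = min ((lam / b) powr (1 / (1 - p))) (crit N b p)"
  have t0: "t0 > 0" using lam0 b crit_pos by (simp add: t0_def)
  have "lam = b * ((lam / b) powr (1 / (1 - p))) powr (1 - p)"
    using lam0 b p by (simp add: powr_powr)
  also have "\<dots> \<le> b * t0 powr (1 - p)"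
    using b p t0 by (intro mult_left_mono powr_mono2') (auto simp: t0_def)
  also have "\<dots> < load N b p t0"
    by (rule load_ge_branches(2)[OF t0])
  finally have l0: "load N b p t0 > lam" .
  moreover have "t0 \<le> crit N b p" by (simp add: t0_def)
  ultimately have "t0 < crit N b p"
    using lam by (auto simp: less_le)
  then obtain t where t: "t0 \<le> t" "t \<le> crit N b p" "load N b p t = lam"
    using IVT2[of "load N b p" "crit N b p" lam t0] l0 lam t0 isCont_load by auto
  moreover have "t \<noteq> crit N b p" using t lam by auto
  ultimately show ?thesis using t0 by (intro exI[of _ t]) auto
qed

lemma ex_large_root:
  assumes lam: "lam > load N b p (crit N b p)"
  shows "\<exists>t. crit N b p < t \<and> load N b p t = lam"
proof -
  \<comment> \<open>Here N t alone reaches \<open>lam\<close>, so \<open>load\<close> is above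
    \<open>lam\<close> at this end of the interval.\<close>
  define t0 where "t0 = max (lam / N) (crit N b p)"
  have t0: "t0 > 0" using crit_pos by (simp add: t0_def)
  have "lam \<le> N * t0" using N by (simp add: t0_def field_simps max_def)
  also have "\<dots> < load N b p t0" by (rule load_ge_branches(1)[OF t0])
  finally have l0: "load N b p t0 > lam" .
  moreover have "crit N b p \<le> t0" by (simp add: t0_def)
  ultimately obtain t where t: "crit N b p \<le> t" "t \<le> t0" "load N b p t = lam"
    using IVT[of "load N b p" "crit N b p" lam t0] lam isCont_load crit_pos by auto
  moreover have "t \<noteq> crit N b p" using t lam by auto
  ultimately show ?thesis by force
qed

text \<open>Both choices are meaningful only for \<open>lam\<close> above the minimum of
  \<open>load\<close>, where monotonicity makes them unique; otherwise the values are
  unspecified.\<close>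

definition "small_root lam = (SOME t. 0 < t \<and> t < crit N b p \<and> load N b p t = lam)"

definition "large_root lam = (SOME t. crit N b p < t \<and> load N b p t = lam)"

lemma small_root:
  assumes "lam > load N b p (crit N b p)"
  shows "0 < small_root lam" "small_root lam < crit N b p" "load N b p (small_root lam) = lam"
  using someI_ex[OF ex_small_root[OF assms]] by (auto simp: small_root_def)

lemma large_root:
  assumes "lam > load N b p (crit N b p)"
  shows "crit N b p < large_root lam" "load N b p (large_root lam) = lam"
  using someI_ex[OF ex_large_root[OF assms]] by (auto simp: large_root_def)

text \<open>Strict monotonicity on either side of the critical point leaves at most one root there,
  and at the critical point \<open>load\<close> takes only its minimal value.\<close>

lemma load_eq_iff_root:
  assumes lam: "lam > load N b p (crit N b p)" and t: "t > 0"
  shows "load N b p t = lam \<longleftrightarrow> t = small_root lam \<or> t = large_root lam"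
proof
  assume eq: "load N b p t = lam"
  have "t \<noteq> crit N b p" using eq lam by auto
  then consider "t < crit N b p" | "t > crit N b p" by linarith
  then show "t = small_root lam \<or> t = large_root lam"
  proof cases
    case 1
    then have "t = small_root lam"
      using load_decreasing[of t "small_root lam"] load_decreasing[of "small_root lam" t]
        small_root[OF lam] t eq by (cases t "small_root lam" rule: linorder_cases) auto
    then show ?thesis ..
  next
    case 2
    then have "t = large_root lam"
      using load_increasing[of t "large_root lam"] load_increasing[of "large_root lam" t]
        large_root[OF lam] t eq by (cases t "large_root lam" rule: linorder_cases) auto
    then show ?thesis ..
  qed
qed (use small_root[OF lam] large_root[OF lam] in auto)

lemma load_eq_crit_iff:
  assumes "t > 0"
  shows "load N b p t = load N b p (crit N b p) \<longleftrightarrow> t = crit N b p"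
  using load_decreasing[of t "crit N b p"] load_increasing[of "crit N b p" t] assms
  by (cases t "crit N b p" rule: linorder_cases) auto

section \<open>Limits of the roots and exact error terms\<close>

lemma eventually_supercritical: "eventually (\<lambda>lam. lam > load N b p (crit N b p)) at_top"
  by (rule eventually_gt_at_top)

text \<open>Since \<open>load\<close> decreases up to the critical point, a small root that is at
  least a forces \<open>lam\<close> to be at most \<open>load N b p a\<close>.\<close>

lemma small_root_tendsto: "(small_root \<longlongrightarrow> 0) at_top"
proof (rule order_tendstoI)
  fix a :: real assume "a < 0"
  show "\<forall>\<^sub>F lam in at_top. a < small_root lam"
    using eventually_supercritical
    by eventually_elim (rule less_trans[OF \<open>a < 0\<close> small_root(1)])
next
  fix a :: real assume a: "0 < a"
  show "\<forall>\<^sub>F lam in at_top. small_root lam < a"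
    using eventually_supercritical eventually_gt_at_top[of "load N b p a"]
  proof eventually_elim
    case (elim lam)
    show ?case
    proof (rule ccontr)
      assume "\<not> small_root lam < a"
      then have "load N b p (small_root lam) \<le> load N b p a"
        using load_decreasing[of a "small_root lam"] small_root[OF elim(1)] a
        by (cases "a = small_root lam") auto
      then show False using small_root(3)[OF elim(1)] elim by simp
    qed
  qed
qed

text \<open>Beyond the critical point the summand b t^(1-p) is at most its value \<open>C\<close>
  there, so N t is at least \<open>lam - C\<close>.\<close>

lemma large_root_at_top: "filterlim large_root at_top at_top"
  unfolding filterlim_at_top
proof
  fix Z :: real
  define C where "C = b * crit N b p powr (1 - p)"
  show "\<forall>\<^sub>F lam in at_top. Z \<le> large_root lam"
    using eventually_supercritical eventually_ge_at_top[of "N * Z + C"]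
  proof eventually_elim
    case (elim lam)
    have "large_root lam powr (1 - p) \<le> crit N b p powr (1 - p)"
      using p large_root(1)[OF elim(1)] crit_pos by (intro powr_mono2') auto
    then have "b * large_root lam powr (1 - p) \<le> C"
      using b by (simp add: C_def)
    then have "N * Z \<le> N * large_root lam"
      using large_root(2)[OF elim(1)] elim(2) by (simp add: load_def)
    then show ?case using N by simp
  qed
qed

text \<open>With \<open>s = N t\<^sup>p / b\<close> the equation reads \<open>\<lambda> = b t\<^sup>1\<^sup>-\<^sup>p (1 + s)\<close>; solving the claimed expansion for its
  error term gives an exact expression in \<open>s\<close>.\<close>

definition "small_err t = (let s = N / b * t powr p in
  (p - 1) * (((1 + s) powr (1 / (p - 1)) - 1) / s) * (1 + s) powr (p / (p - 1)) - 1)"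

text \<open>With q = 1 + s and e = 1 / (p - 1), the prefactor b^e lam^(-e) is t q^(-e) and the
  bracket is exactly q^e; their product is t.\<close>

lemma small_expansion:
  assumes t: "t > 0" and lam: "load N b p t = lam"
  shows "t = b powr (1 / (p - 1)) * lam powr (- 1 / (p - 1)) *
    (1 + 1 / (p - 1) * b powr (1 / (p - 1)) * N * lam powr (- p / (p - 1)) * (1 + small_err t))"
proof -
  define e where "e = 1 / (p - 1)"
  define s where "s = N / b * t powr p"
  define q where "q = 1 + s"
  have s: "s > 0" using t N b by (simp add: s_def)
  have q: "q > 0" using s by (simp add: q_def)
  have tt: "t powr (1 - p) * t powr p = t" using t by (simp flip: powr_add)
  have "lam = b * t powr (1 - p) * q"
    using b tt by (simp add: q_def s_def algebra_simps lam[symmetric] load_def)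
  then have lam_powr: "lam powr a = b powr a * t powr ((1 - p) * a) * q powr a" for a
    using b t q by (simp add: powr_mult powr_powr)
  have e1: "(1 - p) * (- e) = 1" "(1 - p) * (- (p * e)) = p" "- (p * e) + e = - 1"
    using p by (simp_all add: e_def field_simps)
  have A: "b powr e * lam powr (- e) = t * q powr (- e)"
    unfolding lam_powr e1 using b t by (simp add: powr_minus field_simps)
  have B: "e * b powr e * N * lam powr (- (p * e)) * (1 + small_err t) = q powr e - 1"
  proof -
    have err: "1 + small_err t = (p - 1) * ((q powr e - 1) / s) * q powr (p * e)"
      by (simp add: small_err_def Let_def q_def s_def e_def)
    have "b powr (- (p * e)) * b powr e = 1 / b"
      using powr_add[of b "- (p * e)" e] b unfolding e1 by (simp add: powr_minus_divide)
    then have "b powr e * N * lam powr (- (p * e)) = N / b * t powr p * q powr (- (p * e))"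
      unfolding lam_powr e1 by (metis (no_types, opaque_lifting) mult.assoc mult.commute divide_inverse mult_1)
    also have "\<dots> = s * q powr (- (p * e))" by (simp add: s_def)
    finally have "e * b powr e * N * lam powr (- (p * e)) * (1 + small_err t)
        = e * (s * q powr (- (p * e))) * ((p - 1) * ((q powr e - 1) / s) * q powr (p * e))"
      using err by (metis mult.assoc)
    also have "\<dots> = (e * (p - 1)) * (s / s) * (q powr (- (p * e)) * q powr (p * e)) * (q powr e - 1)"
      by simp
    also have "\<dots> = q powr e - 1"
      using s p q by (simp add: e_def flip: powr_add)
    finally show ?thesis .
  qed
  have "b powr e * lam powr (- e) * (1 + e * b powr e * N * lam powr (- (p * e)) * (1 + small_err t))
      = t * (q powr (- e) * q powr e)"
    unfolding A B by simp
  also have "\<dots> = t" using q by (simp flip: powr_add)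
  finally show ?thesis by (simp add: e_def)
qed

text \<open>The quotient in s is a difference quotient of (1 + s)^(1/(p-1)) at 0, whose limit 1 / (p
  - 1) cancels the factor p - 1; the last power tends to 1.\<close>

lemma small_err_tendsto: "((\<lambda>lam. small_err (small_root lam)) \<longlongrightarrow> 0) at_top"
proof -
  define e where "e = 1 / (p - 1)"
  have "((\<lambda>s. (1 + s) powr e) has_real_derivative e) (at 0)"
    by (auto intro!: derivative_eq_intros)
  then have "((\<lambda>s. ((1 + s) powr e - 1) / s) \<longlongrightarrow> e) (at 0)"
    by (simp add: DERIV_def)
  then have "((\<lambda>s. (p - 1) * (((1 + s) powr e - 1) / s) * (1 + s) powr (p / (p - 1)) - 1)
      \<longlongrightarrow> (p - 1) * e * (1 + 0) powr (p / (p - 1)) - 1) (at 0)"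
    by (intro tendsto_intros) auto
  then have lim: "((\<lambda>s. (p - 1) * (((1 + s) powr e - 1) / s) * (1 + s) powr (p / (p - 1)) - 1) \<longlongrightarrow> 0) (at 0)"
    using p by (simp add: e_def)
  \<comment> \<open>The limit is taken at a punctured 0, so s has to tend to 0 through nonzero
    values.\<close>
  have "filterlim (\<lambda>lam. N / b * small_root lam powr p) (at 0) at_top"
    unfolding filterlim_at
  proof
    show "\<forall>\<^sub>F lam in at_top. N / b * small_root lam powr p \<in> UNIV \<and> N / b * small_root lam powr p \<noteq> 0"
      using eventually_supercritical by eventually_elim (use small_root(1) N b in fastforce)
    have "((\<lambda>lam. small_root lam powr p) \<longlongrightarrow> 0) at_top"
      using small_root_tendsto
    proof (rule tendsto_zero_powrI)
      show "\<forall>\<^sub>F lam in at_top. 0 \<le> small_root lam"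
        using eventually_supercritical by eventually_elim (use small_root(1) in fastforce)
    qed (use p in auto)
    then show "((\<lambda>lam. N / b * small_root lam powr p) \<longlongrightarrow> 0) at_top"
      by (rule tendsto_mult_right_zero)
  qed
  from filterlim_compose[OF lim this] show ?thesis
    unfolding small_err_def Let_def e_def .
qed

text \<open>With \<open>A = \<lambda> M\<^sup>1\<^sup>-\<^sup>p\<close> and \<open>N = M\<^sup>p\<close> the equation reads \<open>A = M t + b (M t)\<^sup>1\<^sup>-\<^sup>p\<close>, so the exact error is
  \<open>(M t / A)\<^sup>1\<^sup>-\<^sup>p - 1\<close>.\<close>

definition "large_err t = (1 + b / N * t powr (- p)) powr (p - 1) - 1"

text \<open>With q = 1 + (b / N) t^(-p), the quantity A = lam M^(1-p) equals M t q, and the error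
  term turns A^(1-p) into (M t)^(1-p); subtracting b times this from A leaves M t.\<close>

lemma large_expansion:
  assumes t: "t > 0" and lam: "load N b p t = lam" and M: "M > 0" "M powr p = N"
  shows "t = (lam * M powr (1 - p) - b * (lam * M powr (1 - p)) powr (1 - p) * (1 + large_err t)) * M powr (- 1)"
proof -
  define q where "q = 1 + b / N * t powr (- p)"
  have q: "q > 0" using N b by (simp add: q_def add_pos_nonneg)
  have "t powr (1 - p) = t * t powr (- p)"
    using t by (simp add: powr_diff powr_minus_divide)
  then have "lam = N * t * q"
    using N by (simp add: q_def lam[symmetric] load_def field_simps)
  moreover have MM: "N * M powr (1 - p) = M"
    using M by (simp add: M(2)[symmetric] flip: powr_add)
  ultimately have A: "lam * M powr (1 - p) = M * t * q"
    by (metis mult.assoc mult.commute)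
  have "(M * t * q) powr (1 - p) * (1 + large_err t) = (M * t) powr (1 - p)"
  proof -
    have "q powr (1 - p) * q powr (p - 1) = 1"
      using q by (simp flip: powr_add)
    then show ?thesis
      using M t q unfolding large_err_def q_def[symmetric] by (simp add: powr_mult)
  qed
  moreover have "M * t * q = M * t + b * (M * t) powr (1 - p)"
  proof -
    have "M * t * q = (N * t + b * t powr (1 - p)) * M powr (1 - p)"
      using A lam by (simp add: load_def)
    also have "\<dots> = (N * M powr (1 - p)) * t + b * (M * t) powr (1 - p)"
      using M t by (simp add: powr_mult algebra_simps)
    finally show ?thesis by (simp add: MM)
  qed
  ultimately have "M * t * q - b * ((M * t * q) powr (1 - p) * (1 + large_err t)) = M * t"
    by simp
  then show ?thesis
    unfolding A using M by (simp add: powr_minus field_simps)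
qed

lemma large_err_tendsto: "((\<lambda>lam. large_err (large_root lam)) \<longlongrightarrow> 0) at_top"
proof -
  have "((\<lambda>t. t powr (- p)) \<longlongrightarrow> 0) at_top"
    using p by (intro tendsto_neg_powr filterlim_ident) auto
  then have "((\<lambda>t. (1 + b / N * t powr (- p)) powr (p - 1) - 1) \<longlongrightarrow> (1 + b / N * 0) powr (p - 1) - 1) at_top"
    by (intro tendsto_intros) auto
  then have "(large_err \<longlongrightarrow> 0) at_top"
    by (simp add: large_err_def[abs_def])
  from filterlim_compose[OF this large_root_at_top] show ?thesis .
qed

end

subsection \<open>The solution set\<close>

text \<open>Identifies the threshold as the minimum of \<open>load\<close>. For N = M^p the factor
  N^(-1/p) in the critical point is 1 / M, which reduces M^p to M^(p-1).\<close>

lemma lambda0_eq_load_crit: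
  assumes p: "p > 1" and b: "b > 0"
  shows "lambda0 p b = load (Lp_norm p (W p) powr p) b p (crit (Lp_norm p (W p) powr p) b p)"
proof -
  define M where "M = Lp_norm p (W p)"
  have M: "M > 0" using Lp_norm_W_pos[OF p] by (simp add: M_def)
  have "(M powr p) powr (1 / p) = M" using M p by (simp add: powr_powr)
  then have "M powr p * crit (M powr p) b p = (b * (p - 1)) powr (1 / p) * (M powr p / M)"
    by (simp add: crit_def powr_divide)
  also have "M powr p / M = M powr (p - 1)"
    using M by (simp add: powr_diff)
  finally show ?thesis
    using load_crit[of "M powr p" b p] M p b by (simp add: lambda0_def flip: M_def)
qed

theorem theorem1p3:
  fixes p b :: real
  assumes "p > 1" and "b > 0"
  shows
    "(\<forall>lam. 0 < lam \<and> lam < lambda0 p b \<longrightarrow> \<not> (\<exists>u. P_solution p b lam u)) \<and>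
     (\<exists>!u. P_solution p b (lambda0 p b) u) \<and>
     (\<exists>u1 u2 :: real \<Rightarrow> real \<Rightarrow> real.
        (\<forall>lam > lambda0 p b.
           u1 lam \<noteq> u2 lam \<and> {u. P_solution p b lam u} = {u1 lam, u2 lam}) \<and>
        ((\<lambda>lam. sup_norm (u1 lam)) \<longlongrightarrow> 0) at_top \<and>
        (\<exists>(lambda1 :: real \<Rightarrow> real) r. r \<in> o[at_top](\<lambda>_. 1) \<and>
           (\<forall>lam > lambda0 p b. \<forall>\<alpha>. \<alpha> = sup_norm (u1 lam) \<longrightarrow>
              lam = lambda1 \<alpha> \<and>
              lambda1 \<alpha> = b * sup_norm (W p) powr (p - 1) * \<alpha> powr (- (p - 1)) *
                (1 + b powr (- 1) * Lp_norm p (W p) powr p * sup_norm (W p) powr (- p) *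
                     \<alpha> powr p * (1 + r lam)))) \<and>
        (\<exists>r. r \<in> o[at_top](\<lambda>_. 1) \<and>
           (\<forall>lam > lambda0 p b. \<forall>x\<in>{0..1}.
              u1 lam x = b powr (1 / (p - 1)) * lam powr (- 1 / (p - 1)) *
                (1 + 1 / (p - 1) * b powr (1 / (p - 1)) * Lp_norm p (W p) powr p *
                     lam powr (- p / (p - 1)) * (1 + r lam)) * W p x)) \<and>
        filterlim (\<lambda>lam. sup_norm (u2 lam)) at_top at_top \<and>
        (\<exists>(lambda2 :: real \<Rightarrow> real) r. r \<in> o[at_top](\<lambda>lam. sup_norm (u2 lam) powr (1 - p)) \<and>
           (\<forall>lam > lambda0 p b. \<forall>\<alpha>. \<alpha> = sup_norm (u2 lam) \<longrightarrow>
              lam = lambda2 \<alpha> \<and>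
              lambda2 \<alpha> = Lp_norm p (W p) powr p * sup_norm (W p) powr (- 1) * \<alpha> +
                b * sup_norm (W p) powr (p - 1) * \<alpha> powr (1 - p) + r lam)) \<and>
        (\<exists>r. r \<in> o[at_top](\<lambda>_. 1) \<and>
           (\<forall>lam > lambda0 p b. \<forall>x\<in>{0..1}.
              u2 lam x =
                (lam * Lp_norm p (W p) powr (1 - p) -
                   b * (lam * Lp_norm p (W p) powr (1 - p)) powr (1 - p) * (1 + r lam)) *
                Lp_norm p (W p) powr (- 1) * W p x)))"
proof -
  define M S N where "M = Lp_norm p (W p)" and "S = sup_norm (W p)" and "N = M powr p"
  have M: "M > 0" and S: "S > 0"
    using assms by (simp_all add: M_def S_def Lp_norm_W_pos sup_norm_W_pos)
  then have N: "N > 0" by (simp add: N_def)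
  note params = N \<open>b > 0\<close> \<open>p > 1\<close>
  let ?f = "load N b p" and ?c = "crit N b p"
  let ?t1 = "small_root N b p" and ?t2 = "large_root N b p"
  note small = small_root[OF params] and large = large_root[OF params]
  have lambda0: "lambda0 p b = ?f ?c"
    using lambda0_eq_load_crit assms by (simp add: N_def M_def)
  \<comment> \<open>For positive \<open>lam\<close> counting solutions is now counting positive
    roots of the scalar equation.\<close>
  have sol: "P_solution p b lam u \<longleftrightarrow> (\<exists>t>0. ?f t = lam \<and> u = scaled_W p t)" if "lam > 0" for lam u
    unfolding load_def N_def M_def
    using P_solutionE[OF \<open>p > 1\<close> \<open>b > 0\<close> that, of u] P_solution_scaled_W[OF \<open>p > 1\<close>] by metis
  have f_pos: "?f t > 0" if "t > 0" for t
    using load_ge_branches(1)[OF params that] N that by (meson less_trans mult_pos_pos)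
  have c: "?c > 0" by (rule crit_pos[OF params])
  have t1: "?t1 lam > 0" "?f (?t1 lam) = lam" and t2: "?t2 lam > 0" "?f (?t2 lam) = lam"
    and t12: "?t1 lam < ?t2 lam" if "lam > lambda0 p b" for lam
    using small[of lam] large[of lam] that c by (auto simp: lambda0)
  have sup: "sup_norm (scaled_W p t) = t * S" if "t > 0" for t
    unfolding scaled_W_def S_def by (rule sup_norm_scale[OF continuous_on_W[OF \<open>p > 1\<close>] that])
  have ev: "eventually (\<lambda>lam. lam > lambda0 p b) at_top"
    by (rule eventually_gt_at_top)
  have no_sol: "\<not> (\<exists>u. P_solution p b lam u)" if "0 < lam" "lam < lambda0 p b" for lam
    using sol[OF that(1)] load_crit_le[OF params] that(2) by (fastforce simp: lambda0)
  have one_sol: "\<exists>!u. P_solution p b (lambda0 p b) u"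
    using load_eq_crit_iff[OF params] c by (auto simp: sol lambda0 f_pos[OF c])
  have two_sol: "scaled_W p (?t1 lam) \<noteq> scaled_W p (?t2 lam) \<and>
      {u. P_solution p b lam u} = {scaled_W p (?t1 lam), scaled_W p (?t2 lam)}"
    if lam: "lam > lambda0 p b" for lam
  proof -
    have "lam > 0" using lam f_pos[OF c] by (simp add: lambda0)
    then have "{u. P_solution p b lam u} = scaled_W p ` {t. t > 0 \<and> ?f t = lam}"
      using sol by auto
    also have "{t. t > 0 \<and> ?f t = lam} = {?t1 lam, ?t2 lam}"
      using load_eq_iff_root[OF params] lam t1[OF lam] t2[OF lam] by (auto simp: lambda0)
    finally show ?thesis
      using t12[OF lam] scaled_W_inject[OF \<open>p > 1\<close>] by simp
  qed
  have sup1: "((\<lambda>lam. sup_norm (scaled_W p (?t1 lam))) \<longlongrightarrow> 0) at_top"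
  proof (rule Lim_transform_eventually)
    show "((\<lambda>lam. ?t1 lam * S) \<longlongrightarrow> 0) at_top"
      by (rule tendsto_mult_left_zero[OF small_root_tendsto[OF params]])
    show "\<forall>\<^sub>F lam in at_top. ?t1 lam * S = sup_norm (scaled_W p (?t1 lam))"
      using ev by eventually_elim (simp add: sup t1)
  qed
  have sup2: "filterlim (\<lambda>lam. sup_norm (scaled_W p (?t2 lam))) at_top at_top"
  proof (rule filterlim_cong[THEN iffD1, OF refl refl])
    show "filterlim (\<lambda>lam. ?t2 lam * S) at_top at_top"
      by (rule filterlim_at_top_mult_tendsto_pos[OF tendsto_const S large_root_at_top[OF params]])
    show "\<forall>\<^sub>F lam in at_top. ?t2 lam * S = sup_norm (scaled_W p (?t2 lam))"
      using ev by eventually_elim (simp add: sup t2)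
  qed
  \<comment> \<open>As \<alpha> = t S, the powers of S cancel and the formula is the scalar equation
    itself; the \<open>0\<close> occupies the place of the error term.\<close>
  have lambda1: "?f t = b * S powr (p - 1) * (t * S) powr (- (p - 1)) *
      (1 + b powr (- 1) * M powr p * S powr (- p) * (t * S) powr p * (1 + 0))" if t: "t > 0" for t
  proof -
    have SS: "S powr (p - 1) * S powr (- (p - 1)) = 1" "S powr (- p) * S powr p = 1"
      using S by (simp_all flip: powr_add)
    have "b * S powr (p - 1) * (t * S) powr (- (p - 1)) *
        (1 + b powr (- 1) * M powr p * S powr (- p) * (t * S) powr p * (1 + 0))
        = b * t powr (- (p - 1)) * (S powr (p - 1) * S powr (- (p - 1))) *
          (1 + b powr (- 1) * N * t powr p * (S powr (- p) * S powr p))"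
      by (simp add: powr_mult N_def mult_ac)
    also have "\<dots> = b * t powr (1 - p) * (1 + N / b * t powr p)"
      unfolding SS using \<open>b > 0\<close> by (simp add: powr_minus_divide)
    also have "t powr (1 - p) * t powr p = t" using t by (simp flip: powr_add)
    then have "b * t powr (1 - p) * (1 + N / b * t powr p) = ?f t"
      using \<open>b > 0\<close> by (simp add: load_def algebra_simps)
    finally show ?thesis ..
  qed
  have lambda2: "?f t = M powr p * S powr (- 1) * (t * S) +
      b * S powr (p - 1) * (t * S) powr (1 - p) + 0" if t: "t > 0" for t
  proof -
    have "S powr (p - 1) * S powr (1 - p) = 1" "S powr (- 1) * S = 1"
      using S by (simp_all add: powr_minus flip: powr_add)
    then show ?thesis
      using S t by (simp add: load_def N_def powr_mult)
  qed
  have W_scaled: "scaled_W p t x = t * W p x" if "x \<in> {0..1}" for t x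
    using that by (simp add: scaled_W_def)
  \<comment> \<open>The type confines the rule to the pair of solution families; the existentials
    over \<open>lambda1\<close>, \<open>lambda2\<close> and \<open>r\<close> range over other types
    and stay closed.\<close>
  have ex2I: "\<exists>v w. P v w" if "P v w" for P :: "(real \<Rightarrow> real \<Rightarrow> real) \<Rightarrow> (real \<Rightarrow> real \<Rightarrow> real) \<Rightarrow> bool" and v w
    using that by blast
  show ?thesis
    unfolding M_def[symmetric] S_def[symmetric]
  proof (intro conjI ex2I[of _ "\<lambda>lam. scaled_W p (?t1 lam)" "\<lambda>lam. scaled_W p (?t2 lam)"])
    show "\<forall>lam. 0 < lam \<and> lam < lambda0 p b \<longrightarrow> \<not> (\<exists>u. P_solution p b lam u)"
      using no_sol by blast
    show "\<forall>lam>lambda0 p b. scaled_W p (?t1 lam) \<noteq> scaled_W p (?t2 lam) \<and>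
        {u. P_solution p b lam u} = {scaled_W p (?t1 lam), scaled_W p (?t2 lam)}"
      using two_sol by blast
    \<comment> \<open>The witness recovers t as \<alpha> / S and evaluates \<open>load\<close>
      there, with error identically zero; the same choice serves \<open>lambda2\<close>.\<close>
    show "\<exists>(lambda1 :: real \<Rightarrow> real) r. r \<in> o(\<lambda>_. 1) \<and>
        (\<forall>lam>lambda0 p b. \<forall>\<alpha>. \<alpha> = sup_norm (scaled_W p (?t1 lam)) \<longrightarrow>
          lam = lambda1 \<alpha> \<and>
          lambda1 \<alpha> = b * S powr (p - 1) * \<alpha> powr (- (p - 1)) *
            (1 + b powr (- 1) * M powr p * S powr (- p) * \<alpha> powr p * (1 + r lam)))"
      using S t1 by (intro exI[of _ "\<lambda>\<alpha>. ?f (\<alpha> / S)"] exI[of _ "\<lambda>_. 0"])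
        (auto simp only: sup lambda1[symmetric] nonzero_mult_div_cancel_right less_imp_neq[OF S, symmetric] not_False_eq_True zero_in_smallo)
    show "\<exists>(lambda2 :: real \<Rightarrow> real) r. r \<in> o(\<lambda>lam. sup_norm (scaled_W p (?t2 lam)) powr (1 - p)) \<and>
        (\<forall>lam>lambda0 p b. \<forall>\<alpha>. \<alpha> = sup_norm (scaled_W p (?t2 lam)) \<longrightarrow>
          lam = lambda2 \<alpha> \<and>
          lambda2 \<alpha> = M powr p * S powr (- 1) * \<alpha> + b * S powr (p - 1) * \<alpha> powr (1 - p) + r lam)"
      using S t2 by (intro exI[of _ "\<lambda>\<alpha>. ?f (\<alpha> / S)"] exI[of _ "\<lambda>_. 0"])
        (auto simp only: sup lambda2[symmetric] nonzero_mult_div_cancel_right less_imp_neq[OF S, symmetric] not_False_eq_True zero_in_smallo)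
    show "\<exists>r. r \<in> o(\<lambda>_. 1) \<and> (\<forall>lam>lambda0 p b. \<forall>x\<in>{0..1}.
        scaled_W p (?t1 lam) x = b powr (1 / (p - 1)) * lam powr (- 1 / (p - 1)) *
          (1 + 1 / (p - 1) * b powr (1 / (p - 1)) * M powr p * lam powr (- p / (p - 1)) * (1 + r lam)) * W p x)"
    proof (intro exI[of _ "\<lambda>lam. small_err N b p (?t1 lam)"] conjI allI impI ballI)
      show "(\<lambda>lam. small_err N b p (?t1 lam)) \<in> o(\<lambda>_. 1)"
        using small_err_tendsto[OF params] by (intro smalloI_tendsto) simp_all
      fix lam x :: real assume "lam > lambda0 p b" "x \<in> {0..1}"
      then show "scaled_W p (?t1 lam) x = b powr (1 / (p - 1)) * lam powr (- 1 / (p - 1)) *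
          (1 + 1 / (p - 1) * b powr (1 / (p - 1)) * M powr p * lam powr (- p / (p - 1)) *
            (1 + small_err N b p (?t1 lam))) * W p x"
        unfolding N_def[symmetric] using small_expansion[OF params t1, of lam] W_scaled by metis
    qed
    show "\<exists>r. r \<in> o(\<lambda>_. 1) \<and> (\<forall>lam>lambda0 p b. \<forall>x\<in>{0..1}.
        scaled_W p (?t2 lam) x = (lam * M powr (1 - p) - b * (lam * M powr (1 - p)) powr (1 - p) * (1 + r lam)) *
          M powr (- 1) * W p x)"
    proof (intro exI[of _ "\<lambda>lam. large_err N b p (?t2 lam)"] conjI allI impI ballI)
      show "(\<lambda>lam. large_err N b p (?t2 lam)) \<in> o(\<lambda>_. 1)"
        using large_err_tendsto[OF params] by (intro smalloI_tendsto) simp_all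
      fix lam x :: real assume "lam > lambda0 p b" "x \<in> {0..1}"
      then show "scaled_W p (?t2 lam) x = (lam * M powr (1 - p) -
          b * (lam * M powr (1 - p)) powr (1 - p) * (1 + large_err N b p (?t2 lam))) * M powr (- 1) * W p x"
        using large_expansion[OF params t2 M N_def[symmetric], of lam] W_scaled by metis
    qed
  qed (fact one_sol sup1 sup2)+
qed

end
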